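(* Let $\mathcal{P}_2=\{\mathbb{T}^m \mid m\in\mathbb{N}\}$, where $\mathbb{T}^m$ is the $m$-dimensional torus. Then $\mathcal{N}^{cell}(\mathcal{P}_2)=\mathcal{N}_1^{cell}(\mathcal{P}_2)$ is the class of finite groups.
   Context: Cellular actions: a group $G$ acts cellularly on a CW-complex $X$ if it acts by homeomorphisms permuting the open cells, and the stabilizer of any cell fixes that cell pointwise. The class $\mathcal{N}^{cell}(\mathcal{P})$: for a class $\mathcal{P}$ of finite dimensional CW-complexes, $\mathcal{N}^{cell}(\mathcal{P})$ is the smallest class of groups containing the trivial group with the property that if a group $G$ acts cellularly on some $X\in\mathcal{P}$ such that all isotropy groups are in $\mathcal{N}^{cell}(\mathcal{P})$, then $G$ is in $\mathcal{N}^{cell}(\mathcal{P})$. The subclass $\mathcal{N}_1^{cell}(\mathcal{P})$ consists of the groups that act cellularly on some $X\in\mathcal{P}$ with all isotropy groups trivial. $\mathbb{N}$ is the set of positive integers, and the spaces listed in $\mathcal{P}_2$ are allowed to carry any CW-structure. *)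

theory Defs
  imports "HOL-Analysis.Analysis" "HOL-Algebra.Group_Action"
begin

section \<open>CW-complexes\<close>

definition disk :: "nat \<Rightarrow> (nat \<Rightarrow> real) topology" where
  "disk n = subtopology (Euclidean_space n) {x. (\<Sum>i<n. (x i)\<^sup>2) \<le> 1}"

definition open_disk :: "nat \<Rightarrow> (nat \<Rightarrow> real) set" where
  "open_disk n = {x \<in> topspace (disk n). (\<Sum>i<n. (x i)\<^sup>2) < 1}"

definition disk_boundary :: "nat \<Rightarrow> (nat \<Rightarrow> real) set" where
  "disk_boundary n = {x \<in> topspace (disk n). (\<Sum>i<n. (x i)\<^sup>2) = 1}"

text \<open>\<open>cells X n\<close> is the set of open \<open>n\<close>-cells of \<open>X\<close>. Characteristic maps are not part of
  the data; only their existence is required.\<close>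

record 'x cw =
  cw_space :: "'x topology"
  cells :: "nat \<Rightarrow> 'x set set"

definition all_cells :: "'x cw \<Rightarrow> 'x set set" where
  "all_cells X = (\<Union>n. cells X n)"

definition characteristic_map :: "'x cw \<Rightarrow> nat \<Rightarrow> 'x set \<Rightarrow> ((nat \<Rightarrow> real) \<Rightarrow> 'x) \<Rightarrow> bool" where
  "characteristic_map X n e f \<longleftrightarrow>
     continuous_map (disk n) (cw_space X) f \<and>
     homeomorphic_map (subtopology (disk n) (open_disk n)) (subtopology (cw_space X) e) f \<and>
     f ` disk_boundary n \<subseteq> (\<Union>k<n. \<Union>(cells X k))"

definition cw_complex :: "'x cw \<Rightarrow> bool" where
  "cw_complex X \<longleftrightarrow>
     Hausdorff_space (cw_space X) \<and>
     partition_on (topspace (cw_space X)) (all_cells X) \<and>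
     (\<forall>n. \<forall>e \<in> cells X n. \<exists>f. characteristic_map X n e f) \<and>
     \<comment> \<open>closure finiteness\<close>
     (\<forall>e \<in> all_cells X. finite {d \<in> all_cells X. d \<inter> (cw_space X closure_of e) \<noteq> {}}) \<and>
     \<comment> \<open>weak topology\<close>
     (\<forall>A \<subseteq> topspace (cw_space X).
        (\<forall>e \<in> all_cells X. closedin (cw_space X) (A \<inter> (cw_space X closure_of e)))
          \<longrightarrow> closedin (cw_space X) A)"


section \<open>Cellular actions\<close>

definition cellular_action :: "'a monoid \<Rightarrow> 'x cw \<Rightarrow> ('a \<Rightarrow> 'x \<Rightarrow> 'x) \<Rightarrow> bool" where
  "cellular_action G X \<phi> \<longleftrightarrow>
     group_action G (topspace (cw_space X)) \<phi> \<and>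
     (\<forall>g \<in> carrier G. homeomorphic_map (cw_space X) (cw_space X) (\<phi> g)) \<and>
     (\<forall>g \<in> carrier G. \<forall>e \<in> all_cells X. \<phi> g ` e \<in> all_cells X) \<and>
     (\<forall>g \<in> carrier G. \<forall>e \<in> all_cells X. \<phi> g ` e = e \<longrightarrow> (\<forall>x \<in> e. \<phi> g x = x))"

definition isotropy_group :: "'a monoid \<Rightarrow> ('a \<Rightarrow> 'x \<Rightarrow> 'x) \<Rightarrow> 'x \<Rightarrow> 'a monoid" where
  "isotropy_group G \<phi> x = G\<lparr>carrier := stabilizer G \<phi> x\<rparr>"


section \<open>The classes of groups\<close>

text \<open>Isotropy groups are subgroups of the acting group, so the closure process never leaves the
  element type \<open>'a\<close> of \<open>G\<close>. A class of groups is therefore rendered as a set of groups over an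
  arbitrary type \<open>'a\<close>. Finite dimensionality of the members of \<open>P\<close> is not needed to state the
  definitions; in the case of interest it is automatic, since the spaces are compact.\<close>

inductive_set N_cell :: "'x cw set \<Rightarrow> 'a monoid set" for P :: "'x cw set" where
  trivial: "group G \<Longrightarrow> carrier G = {\<one>\<^bsub>G\<^esub>} \<Longrightarrow> G \<in> N_cell P"
| step: "X \<in> P \<Longrightarrow> cellular_action G X \<phi> \<Longrightarrow>
    (\<forall>x \<in> topspace (cw_space X). isotropy_group G \<phi> x \<in> N_cell P) \<Longrightarrow> G \<in> N_cell P"

definition N1_cell :: "'x cw set \<Rightarrow> 'a monoid set" where
  "N1_cell P = {G. \<exists>X \<in> P. \<exists>\<phi>. cellular_action G X \<phi> \<and>
     (\<forall>x \<in> topspace (cw_space X). carrier (isotropy_group G \<phi> x) = {\<one>\<^bsub>G\<^esub>})}"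


section \<open>Tori\<close>

definition torus :: "nat \<Rightarrow> (nat \<Rightarrow> complex) topology" where
  "torus m = product_topology (\<lambda>i. top_of_set (sphere 0 1)) {..<m}"

definition P2 :: "(nat \<Rightarrow> complex) cw set" where
  "P2 = {X. cw_complex X \<and> (\<exists>m\<ge>1. cw_space X = torus m)}"

end

theory Submission
  imports Defs "HOL-Algebra.Multiplicative_Group"
begin

text \<open>The three classes are compared in a circle. A group acting with trivial isotropy lies in the
  closure by definition.

  Everything in the closure is finite: a CW structure on a compact space has only finitely many
  cells (\<open>compact_cw_complex_finite_cells\<close>), so an open cell has a finite orbit, and since the
  stabilizer of a cell fixes it pointwise, this stabilizer is contained in the isotropy group of any
  point of the cell. Hence the group is finite as soon as one isotropy group is
  (\<open>finite_group_if_finite_isotropy\<close>), and rule induction applies.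

  Conversely, a finite group \<open>G\<close> acts freely on a torus. For \<open>c \<in> G\<close> let \<open>C\<close> be the cyclic group
  generated by \<open>c\<close>, acting on the circle by rotation through a primitive root of unity \<open>\<omega>\<close> of order
  \<open>ord c\<close>. The coinduced space of functions \<open>f\<close> from \<open>G\<close> to the circle with \<open>f (x c) = \<omega> f x\<close> is a
  torus with one coordinate for each coset \<open>x C\<close>, and \<open>c\<close> rotates the coordinate of the coset \<open>C\<close>.
  So \<open>c\<close> moves every point of this torus unless \<open>c\<close> is trivial, and the product of these tori over all \<open>c \<in> G\<close> is a
  free \<open>G\<close>-space. Choosing coset representatives turns the action into a monomial one: coordinates
  are permuted and multiplied by roots of unity of order dividing \<open>|G|\<close>
  (\<open>finite_group_in_N1_cell\<close>).

  Such an action permutes the cells of the product structure in which every circle is cut at the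
  \<open>|G|\<close>-th roots of unity (\<open>cw_complex_torus_cw\<close>). It is cellular because it is free: a group
  element that preserves a cell fixes the centre of that cell, so it is trivial
  (\<open>monomial_action_in_N1_cell\<close>).\<close>

section \<open>Finiteness of compact CW complexes and of the groups acting on them\<close>

lemma topspace_torus: "topspace (torus m) = {..<m} \<rightarrow>\<^sub>E sphere 0 1"
  by (simp add: torus_def)

lemma compact_space_torus: "compact_space (torus m)"
  by (simp add: torus_def compact_space_product_topology compact_space_subtopology)

lemma Hausdorff_space_torus: "Hausdorff_space (torus m)"
  by (simp add: torus_def Hausdorff_space_product_topology Hausdorff_space_subtopology)

text \<open>Choose a point in every cell. By closure finiteness any set of chosen points meets the closure of
  each cell in a finite set, so it is closed in the weak topology. The chosen points therefore form a
  closed discrete subspace of a compact space.\<close>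

lemma compact_cw_complex_finite_cells:
  assumes X: "cw_complex X" and compact: "compact_space (cw_space X)"
  shows "finite (all_cells X)"
proof -
  define p where "p e = (SOME x. x \<in> e)" for e :: "'a set"
  define D where "D = p ` all_cells X"
  have part: "partition_on (topspace (cw_space X)) (all_cells X)"
    using X by (simp add: cw_complex_def)
  have p: "p e \<in> e" if "e \<in> all_cells X" for e
    using partition_onD3 [OF part] that unfolding p_def by (metis ex_in_conv someI_ex)
  have D_sub: "D \<subseteq> topspace (cw_space X)"
    using p partition_onD1 [OF part] by (auto simp: D_def)
  have closed: "closedin (cw_space X) A" if "A \<subseteq> D" for A
  proof -
    have "finite (A \<inter> cw_space X closure_of e)" if e: "e \<in> all_cells X" for e
    proof (rule finite_subset)
      show "A \<inter> cw_space X closure_of e \<subseteq> p ` {d \<in> all_cells X. d \<inter> cw_space X closure_of e \<noteq> {}}"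
        using \<open>A \<subseteq> D\<close> p unfolding D_def by blast
      show "finite (p ` {d \<in> all_cells X. d \<inter> cw_space X closure_of e \<noteq> {}})"
        using X e unfolding cw_complex_def by blast
    qed
    then have "closedin (cw_space X) (A \<inter> cw_space X closure_of e)" if "e \<in> all_cells X" for e
      using that X D_sub \<open>A \<subseteq> D\<close>
      by (intro closedin_Hausdorff_finite) (auto simp: cw_complex_def)
    then show ?thesis
      using X D_sub \<open>A \<subseteq> D\<close> unfolding cw_complex_def by blast
  qed
  have "openin (subtopology (cw_space X) D) {x}" if "x \<in> D" for x
  proof -
    have "closedin (subtopology (cw_space X) D) (D - {x})"
      using closed [of "D - {x}"] closedin_subset_topspace by fastforce
    moreover have "D - (D - {x}) = {x}" using that by blast
    ultimately show ?thesis
      using D_sub by (simp add: closedin_def Int_absorb1)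
  qed
  then have "discrete_topology D = subtopology (cw_space X) D"
    using D_sub by (simp add: discrete_topology_unique Int_absorb1)
  moreover have "compact_space (subtopology (cw_space X) D)"
    using compact closed [of D] by (simp add: closedin_compact_space compact_space_subtopology)
  ultimately have "finite D"
    by (metis compact_space_discrete_topology)
  moreover have "inj_on p (all_cells X)"
  proof (rule inj_onI)
    fix e d assume "e \<in> all_cells X" "d \<in> all_cells X" "p e = p d"
    then have "e \<inter> d \<noteq> {}" using p by (metis disjoint_iff)
    then show "e = d"
      using \<open>e \<in> _\<close> \<open>d \<in> _\<close> partition_onD2 [OF part] by (auto simp: disjoint_def)
  qed
  ultimately show ?thesis
    unfolding D_def by (rule finite_imageD)
qed

text \<open>The elements moving \<open>e\<close> to a given cell \<open>d\<close> form a coset of the stabilizer of \<open>e\<close>, which is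
  contained in the isotropy group of \<open>x\<close>; and there are finitely many candidates for \<open>d\<close>.\<close>

lemma finite_group_if_finite_isotropy:
  assumes act: "cellular_action G X \<phi>" and fin: "finite (all_cells X)"
    and x: "x \<in> e" and e: "e \<in> all_cells X" and eX: "e \<subseteq> topspace (cw_space X)"
    and stab: "finite (stabilizer G \<phi> x)"
  shows "finite (carrier G)"
proof -
  interpret group_action G "topspace (cw_space X)" \<phi>
    using act by (simp add: cellular_action_def)
  interpret group G using group_hom by (simp add: group_hom_def)
  have "finite {g \<in> carrier G. \<phi> g ` e = d}" for d
  proof (cases "\<exists>h \<in> carrier G. \<phi> h ` e = d")
    case True
    then obtain h where h: "h \<in> carrier G" "\<phi> h ` e = d" by blast
    have "{g \<in> carrier G. \<phi> g ` e = d} \<subseteq> (\<lambda>s. h \<otimes>\<^bsub>G\<^esub> s) ` stabilizer G \<phi> x"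
    proof
      fix g assume "g \<in> {g \<in> carrier G. \<phi> g ` e = d}"
      then have g: "g \<in> carrier G" "\<phi> g ` e = d" by auto
      define s where "s = inv\<^bsub>G\<^esub> h \<otimes>\<^bsub>G\<^esub> g"
      have s: "s \<in> carrier G" using g h by (simp add: s_def)
      have "\<phi> s ` e = \<phi> (inv\<^bsub>G\<^esub> h) ` (\<phi> g ` e)"
        unfolding s_def image_image using g h eX by (intro image_cong) (auto simp: composition_rule)
      also have "\<dots> = \<phi> (inv\<^bsub>G\<^esub> h) ` (\<phi> h ` e)" using g h by simp
      also have "\<dots> = (\<lambda>x. x) ` e"
        unfolding image_image using h eX
        by (intro image_cong) (auto simp: composition_rule [symmetric] id_eq_one [symmetric])
      finally have "\<phi> s ` e = e" by simp
      then have "s \<in> stabilizer G \<phi> x"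
        using act s e x by (auto simp: cellular_action_def stabilizer_def)
      moreover have "g = h \<otimes>\<^bsub>G\<^esub> s" using g h by (simp add: s_def m_assoc [symmetric])
      ultimately show "g \<in> (\<lambda>s. h \<otimes>\<^bsub>G\<^esub> s) ` stabilizer G \<phi> x" by blast
    qed
    then show ?thesis using stab finite_surj by blast
  next
    case False then show ?thesis by (metis (mono_tags, lifting) empty_Collect_eq finite.emptyI)
  qed
  then have "finite (\<Union>d \<in> all_cells X. {g \<in> carrier G. \<phi> g ` e = d})"
    using fin by blast
  moreover have "carrier G \<subseteq> (\<Union>d \<in> all_cells X. {g \<in> carrier G. \<phi> g ` e = d})"
    using act e by (auto simp: cellular_action_def)
  ultimately show ?thesis by (rule finite_subset [rotated])
qed

lemma N_cell_P2_finite: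
  assumes "G \<in> N_cell P2"
  shows "group G \<and> finite (carrier G)"
  using assms
proof induction
  case (trivial G)
  then show ?case by simp
next
  case (step X G \<phi>)
  obtain m where X: "cw_complex X" "cw_space X = torus m"
    using step.hyps(1) by (auto simp: P2_def)
  have "(\<lambda>i\<in>{..<m}. 1) \<in> topspace (cw_space X)"
    by (simp add: X topspace_torus)
  then obtain e where e: "(\<lambda>i\<in>{..<m}. 1) \<in> e" "e \<in> all_cells X"
    using X unfolding cw_complex_def partition_on_def by blast
  have "finite (carrier G)"
  proof (rule finite_group_if_finite_isotropy [OF step.hyps(2) _ e])
    show "finite (all_cells X)"
      using X by (simp add: compact_cw_complex_finite_cells compact_space_torus)
    show "e \<subseteq> topspace (cw_space X)"
      using X e unfolding cw_complex_def partition_on_def by blast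
    then show "finite (stabilizer G \<phi> (\<lambda>i\<in>{..<m}. 1))"
      using step.IH e by (auto simp: isotropy_group_def)
  qed
  moreover have "group G"
    using step.hyps(2) by (simp add: cellular_action_def group_action_def group_hom_def)
  ultimately show ?case by simp
qed

lemma N1_cell_subset_N_cell: "(N1_cell P :: 'b monoid set) \<subseteq> N_cell P"
proof
  fix G :: "'b monoid" assume "G \<in> N1_cell P"
  then obtain X \<phi> where X: "X \<in> P" "cellular_action G X \<phi>"
    and free: "\<forall>x \<in> topspace (cw_space X). carrier (isotropy_group G \<phi> x) = {\<one>\<^bsub>G\<^esub>}"
    by (auto simp: N1_cell_def)
  interpret group_action G "topspace (cw_space X)" \<phi>
    using X by (simp add: cellular_action_def)
  interpret group G using group_hom by (simp add: group_hom_def)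
  have "isotropy_group G \<phi> x \<in> N_cell P" if x: "x \<in> topspace (cw_space X)" for x
  proof (rule N_cell.trivial)
    show "group (isotropy_group G \<phi> x)"
      unfolding isotropy_group_def by (rule subgroup_imp_group) (rule stabilizer_subgroup [OF x])
    show "carrier (isotropy_group G \<phi> x) = {\<one>\<^bsub>isotropy_group G \<phi> x\<^esub>}"
      using free x by (simp add: isotropy_group_def)
  qed
  then show "G \<in> N_cell P" using X by (intro N_cell.step [of X P G \<phi>] ballI) auto
qed

section \<open>Round disks and cubes\<close>

text \<open>Both norms depend on the first \<open>k\<close> coordinates only. The recursive form makes the continuity of the
  maximum norm an immediate induction.\<close>

primrec sup_norm :: "nat \<Rightarrow> (nat \<Rightarrow> real) \<Rightarrow> real" where
  "sup_norm 0 x = 0"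
| "sup_norm (Suc k) x = max (sup_norm k x) \<bar>x k\<bar>"

definition eucl_norm :: "nat \<Rightarrow> (nat \<Rightarrow> real) \<Rightarrow> real" where
  "eucl_norm k x = sqrt (\<Sum>i<k. (x i)\<^sup>2)"

text \<open>For norms \<open>p\<close> and \<open>q\<close>, this map takes the unit ball of \<open>p\<close> to that of \<open>q\<close> along each ray. At the
  origin the quotient has the value \<open>0\<close>, so the origin is fixed.\<close>

definition rescale :: "((nat \<Rightarrow> real) \<Rightarrow> real) \<Rightarrow> ((nat \<Rightarrow> real) \<Rightarrow> real) \<Rightarrow> (nat \<Rightarrow> real) \<Rightarrow> nat \<Rightarrow> real" where
  "rescale p q x = (\<lambda>i. (p x / q x) * x i)"

lemma sup_norm_nonneg: "0 \<le> sup_norm k x"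
  by (induction k) auto

lemma abs_le_sup_norm: "i < k \<Longrightarrow> \<bar>x i\<bar> \<le> sup_norm k x"
  by (induction k) (auto simp: less_Suc_eq)

lemma sup_norm_attained: "sup_norm k x \<noteq> 0 \<Longrightarrow> \<exists>i<k. \<bar>x i\<bar> = sup_norm k x"
  by (induction k) (auto simp: max_def less_Suc_eq split: if_splits)

lemma sup_norm_scale: "sup_norm k (\<lambda>i. c * x i) = \<bar>c\<bar> * sup_norm k x"
  by (induction k) (auto simp: abs_mult max_mult_distrib_left)

lemma sup_norm_le_eucl_norm: "sup_norm k x \<le> eucl_norm k x"
proof (cases "sup_norm k x = 0")
  case False
  then obtain i where "i < k" "\<bar>x i\<bar> = sup_norm k x" using sup_norm_attained by blast
  moreover from \<open>i < k\<close> have "(x i)\<^sup>2 \<le> (\<Sum>i<k. (x i)\<^sup>2)"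
    by (intro member_le_sum) auto
  ultimately show ?thesis
    unfolding eucl_norm_def by (metis real_sqrt_abs real_sqrt_le_mono)
qed (simp add: eucl_norm_def sum_nonneg)

lemma eucl_norm_scale: "eucl_norm k (\<lambda>i. c * x i) = \<bar>c\<bar> * eucl_norm k x"
  by (simp add: eucl_norm_def power_mult_distrib sum_distrib_left [symmetric] real_sqrt_mult)

lemma eucl_norm_nonneg: "0 \<le> eucl_norm k x"
  by (simp add: eucl_norm_def sum_nonneg)

lemma sup_norm_eq_0_iff: "sup_norm k x = 0 \<longleftrightarrow> (\<forall>i<k. x i = 0)"
  by (metis abs_le_sup_norm abs_le_zero_iff abs_zero sup_norm_attained)

lemma eucl_norm_eq_0_iff: "eucl_norm k x = 0 \<longleftrightarrow> (\<forall>i<k. x i = 0)"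
  by (auto simp: eucl_norm_def sum_nonneg_eq_0_iff)

lemma rescale_rescale:
  assumes q: "\<And>c x. q (\<lambda>i. c * x i) = \<bar>c\<bar> * q x" and p: "\<And>c x. p (\<lambda>i. c * x i) = \<bar>c\<bar> * p x"
    and nonneg: "\<And>x. 0 \<le> p x" "\<And>x. 0 \<le> q x"
    and zero: "\<And>x. p x = 0 \<longleftrightarrow> q x = 0" and x: "q x = 0 \<Longrightarrow> x = (\<lambda>i. 0)"
  shows "rescale q p (rescale p q x) = x" "q (rescale p q x) = p x"
proof -
  have "q (rescale p q x) = \<bar>p x / q x\<bar> * q x"
    unfolding rescale_def by (rule q)
  then show q_eq: "q (rescale p q x) = p x"
    using nonneg [of x] zero [of x] by auto
  have "p (rescale p q x) = \<bar>p x / q x\<bar> * p x"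
    unfolding rescale_def by (rule p)
  then show "rescale q p (rescale p q x) = x"
    using nonneg [of x] zero [of x] x q_eq
    unfolding rescale_def [of q p] by (cases "q x = 0") (auto simp: rescale_def)
qed

definition disk_to_cube :: "nat \<Rightarrow> (nat \<Rightarrow> real) \<Rightarrow> nat \<Rightarrow> real" where
  "disk_to_cube k = rescale (eucl_norm k) (sup_norm k)"

definition cube_to_disk :: "nat \<Rightarrow> (nat \<Rightarrow> real) \<Rightarrow> nat \<Rightarrow> real" where
  "cube_to_disk k = rescale (sup_norm k) (eucl_norm k)"

lemma
  assumes "\<forall>i\<ge>k. x i = 0"
  shows cube_to_disk_disk_to_cube: "cube_to_disk k (disk_to_cube k x) = x"
    and sup_norm_disk_to_cube: "sup_norm k (disk_to_cube k x) = eucl_norm k x"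
    and disk_to_cube_cube_to_disk: "disk_to_cube k (cube_to_disk k x) = x"
    and eucl_norm_cube_to_disk: "eucl_norm k (cube_to_disk k x) = sup_norm k x"
proof -
  have zero: "x = (\<lambda>i. 0)" if "\<forall>i<k. x i = 0"
    using assms that by (auto simp: fun_eq_iff) (metis not_le)
  have zero_iff: "eucl_norm k y = 0 \<longleftrightarrow> sup_norm k y = 0" for y
    by (simp add: eucl_norm_eq_0_iff sup_norm_eq_0_iff)
  note norms = sup_norm_scale eucl_norm_scale sup_norm_nonneg eucl_norm_nonneg
  note rescale_1 = rescale_rescale [of "sup_norm k" "eucl_norm k" x,
      OF norms(1,2,4,3) zero_iff zero [unfolded sup_norm_eq_0_iff [symmetric]]]
  note rescale_2 = rescale_rescale [of "eucl_norm k" "sup_norm k" x,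
      OF norms(2,1,3,4) zero_iff [symmetric] zero [unfolded eucl_norm_eq_0_iff [symmetric]]]
  show "cube_to_disk k (disk_to_cube k x) = x" "sup_norm k (disk_to_cube k x) = eucl_norm k x"
    "disk_to_cube k (cube_to_disk k x) = x" "eucl_norm k (cube_to_disk k x) = sup_norm k x"
    unfolding cube_to_disk_def disk_to_cube_def using rescale_1 rescale_2 by simp_all
qed

lemma topspace_disk: "topspace (disk k) = {x. (\<forall>i\<ge>k. x i = 0) \<and> eucl_norm k x \<le> 1}"
  by (auto simp: disk_def topspace_Euclidean_space eucl_norm_def)

lemma open_disk_eq: "open_disk k = {x. (\<forall>i\<ge>k. x i = 0) \<and> eucl_norm k x < 1}"
  by (auto simp: open_disk_def disk_def topspace_Euclidean_space eucl_norm_def)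

lemma disk_boundary_eq: "disk_boundary k = {x. (\<forall>i\<ge>k. x i = 0) \<and> eucl_norm k x = 1}"
  by (auto simp: disk_boundary_def disk_def topspace_Euclidean_space eucl_norm_def)

lemma topspace_disk_decomp: "topspace (disk k) = open_disk k \<union> disk_boundary k"
  by (auto simp: topspace_disk open_disk_eq disk_boundary_eq)

lemma continuous_map_disk_coordinate: "continuous_map (disk k) euclideanreal (\<lambda>x. x i)"
  unfolding disk_def Euclidean_space_def subtopology_subtopology
  by (intro continuous_map_from_subtopology continuous_map_product_projection) simp

lemma continuous_map_eucl_norm: "continuous_map (disk k) euclideanreal (eucl_norm k)"
  unfolding eucl_norm_def [abs_def]
  by (intro continuous_intros continuous_map_disk_coordinate) auto

lemma continuous_map_sup_norm: "continuous_map (disk n) euclideanreal (sup_norm k)"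
proof (induction k)
  case 0
  have "sup_norm 0 = (\<lambda>x. 0)" by (simp add: fun_eq_iff)
  then show ?case by simp
next
  case (Suc k)
  have "sup_norm (Suc k) = (\<lambda>x. max (sup_norm k x) \<bar>x k\<bar>)" by (simp add: fun_eq_iff)
  then show ?case
    using Suc by (auto intro!: continuous_intros continuous_map_disk_coordinate)
qed

lemma disk_to_cube_le_eucl_norm:
  assumes "i < k" shows "\<bar>disk_to_cube k x i\<bar> \<le> eucl_norm k x"
proof -
  have "\<bar>disk_to_cube k x i\<bar> = eucl_norm k x * (\<bar>x i\<bar> / sup_norm k x)"
    by (simp add: disk_to_cube_def rescale_def abs_mult sup_norm_nonneg eucl_norm_nonneg)
  also have "\<dots> \<le> eucl_norm k x * 1"
    using abs_le_sup_norm [OF assms, of x] sup_norm_nonneg [of k x]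
    by (intro mult_left_mono eucl_norm_nonneg) (auto simp: divide_le_eq_1)
  finally show ?thesis by simp
qed

text \<open>Only the origin needs an argument, because there the denominator vanishes: each coordinate of the
  image is bounded by the Euclidean norm, which tends to \<open>0\<close>.\<close>

lemma continuous_map_disk_to_cube:
  assumes "i < k"
  shows "continuous_map (disk k) euclideanreal (\<lambda>x. disk_to_cube k x i)"
  unfolding continuous_map_atin
proof
  fix x assume x: "x \<in> topspace (disk k)"
  have eucl: "(eucl_norm k \<longlongrightarrow> eucl_norm k x) (atin (disk k) x)"
    using x continuous_map_eucl_norm [of k] unfolding continuous_map_atin by simp
  have sup: "(sup_norm k \<longlongrightarrow> sup_norm k x) (atin (disk k) x)"
    using x continuous_map_sup_norm [of k] unfolding continuous_map_atin by simp
  have coord: "((\<lambda>x. x i) \<longlongrightarrow> x i) (atin (disk k) x)"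
    using x continuous_map_disk_coordinate [of k i] unfolding continuous_map_atin by simp
  have "((\<lambda>x. disk_to_cube k x i) \<longlongrightarrow> disk_to_cube k x i) (atin (disk k) x)"
  proof (cases "sup_norm k x = 0")
    case True
    then have "eucl_norm k x = 0" by (simp add: eucl_norm_eq_0_iff sup_norm_eq_0_iff)
    with eucl have "(eucl_norm k \<longlongrightarrow> 0) (atin (disk k) x)" by simp
    then have "((\<lambda>x. disk_to_cube k x i) \<longlongrightarrow> 0) (atin (disk k) x)"
      by (rule Lim_null_comparison [rotated]) (simp add: disk_to_cube_le_eucl_norm assms)
    then show ?thesis using True by (simp add: disk_to_cube_def rescale_def)
  next
    case False
    then show ?thesis
      unfolding disk_to_cube_def rescale_def by (intro tendsto_intros eucl sup coord)
  qed
  then show "limitin euclideanreal (\<lambda>x. disk_to_cube k x i) (disk_to_cube k x i) (atin (disk k) x)"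
    by simp
qed

text \<open>The disk is a closed subset of a product of intervals and points, which is compact by Tychonoff's
  theorem.\<close>

lemma compact_space_disk: "compact_space (disk k)"
proof -
  define C where "C = (\<Pi>\<^sub>E i\<in>(UNIV::nat set). if i < k then {-1..1::real} else {0})"
  have "disk k = subtopology (powertop_real UNIV) (topspace (disk k))"
    by (simp add: disk_def Euclidean_space_def subtopology_subtopology topspace_Euclidean_space)
  moreover have "compactin (powertop_real UNIV) (topspace (disk k))"
  proof (rule closed_compactin)
    show "compactin (powertop_real UNIV) C"
      unfolding C_def by (subst compactin_PiE) auto
    show "topspace (disk k) \<subseteq> C"
    proof
      fix x assume x: "x \<in> topspace (disk k)"
      then have "\<bar>x i\<bar> \<le> 1" if "i < k" for i
        using abs_le_sup_norm [OF that, of x] sup_norm_le_eucl_norm [of k x]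
        by (simp add: topspace_disk)
      then show "x \<in> C"
        using x by (auto simp: C_def topspace_disk abs_le_iff not_less minus_le_iff)
    qed
    have "closedin (powertop_real UNIV) ({x. \<forall>i\<ge>k. x i = 0} \<inter> {x. (\<Sum>i<k. (x i)\<^sup>2) \<le> 1})"
    proof (rule closedin_Int)
      show "closedin (powertop_real UNIV) {x. \<forall>i\<ge>k. x i = (0::real)}"
        using closedin_Euclidean_space [of k] by (simp add: topspace_Euclidean_space)
      have "closedin (powertop_real UNIV) {x \<in> topspace (powertop_real UNIV). (\<Sum>i<k. (x i)\<^sup>2) \<in> {..1}}"
        by (intro closedin_continuous_map_preimage [where Y = euclideanreal] continuous_intros
             continuous_map_product_projection) auto
      then show "closedin (powertop_real UNIV) {x. (\<Sum>i<k. (x i)\<^sup>2) \<le> (1::real)}"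
        by simp
    qed
    moreover have "topspace (disk k) = {x. \<forall>i\<ge>k. x i = 0} \<inter> {x. (\<Sum>i<k. (x i)\<^sup>2) \<le> 1}"
      by (auto simp: disk_def topspace_Euclidean_space)
    ultimately show "closedin (powertop_real UNIV) (topspace (disk k))"
      by simp
  qed
  ultimately show ?thesis by (metis compact_space_subtopology)
qed

text \<open>The map is closed, from a compact space to a Hausdorff space, and stays closed when restricted to
  the full preimage of \<open>e\<close>. Hence no continuous inverse has to be exhibited: injectivity on the open
  disk is enough.\<close>

lemma characteristic_mapI:
  assumes Hausdorff: "Hausdorff_space (cw_space X)"
    and cont: "continuous_map (disk k) (cw_space X) f"
    and image: "f ` open_disk k = e" and inj: "inj_on f (open_disk k)"
    and boundary: "f ` disk_boundary k \<subseteq> (\<Union>j<k. \<Union>(cells X j))"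
    and disjoint: "f ` disk_boundary k \<inter> e = {}"
  shows "characteristic_map X k e f"
  unfolding characteristic_map_def
proof (intro conjI cont boundary)
  have open_sub: "open_disk k \<subseteq> topspace (disk k)" by (simp add: open_disk_def)
  have e_sub: "e \<subseteq> topspace (cw_space X)"
    using image open_sub cont by (auto simp: continuous_map_def)
  have "closed_map (disk k) (cw_space X) f"
    using cont compact_space_disk Hausdorff by (rule continuous_imp_closed_map)
  moreover have "{x \<in> topspace (disk k). f x \<in> e} = open_disk k"
    using image disjoint by (auto simp: topspace_disk_decomp)
  ultimately have "closed_map (subtopology (disk k) (open_disk k)) (subtopology (cw_space X) e) f"
    by (rule closed_map_restriction)
  moreover have "continuous_map (subtopology (disk k) (open_disk k)) (subtopology (cw_space X) e) f"
    using cont image by (auto simp: continuous_map_in_subtopology continuous_map_from_subtopology)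
  ultimately show "homeomorphic_map (subtopology (disk k) (open_disk k)) (subtopology (cw_space X) e) f"
    using image inj
    by (intro bijective_closed_imp_homeomorphic_map) (simp_all add: Int_absorb1 [OF open_sub] Int_absorb1 [OF e_sub])
qed

section \<open>Product cell structures on tori\<close>

text \<open>Increasing \<open>x\<close> by \<open>1\<close> rotates the point by \<open>2 \<pi> / n\<close>, so that the integers parametrize the
  vertices of the subdivided circle.\<close>

definition circle_point :: "nat \<Rightarrow> real \<Rightarrow> complex" where
  "circle_point n x = cis (2 * pi * x / n)"

definition cell_params :: "bool \<Rightarrow> real set" where
  "cell_params b = (if b then {0<..<1} else {0})"

text \<open>The vertex \<open>a\<close> if \<open>b\<close> is false, and the open arc from vertex \<open>a\<close> to vertex \<open>a + 1\<close> otherwise. The index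
  \<open>a\<close> is read modulo \<open>n\<close>; leaving it an arbitrary integer makes rotation a translation of \<open>a\<close>.\<close>

definition circle_cell :: "nat \<Rightarrow> int \<Rightarrow> bool \<Rightarrow> complex set" where
  "circle_cell n a b = (\<lambda>s. circle_point n (a + s)) ` cell_params b"

lemma circle_point_eq_iff:
  assumes "n > 0"
  shows "circle_point n x = circle_point n y \<longleftrightarrow> (\<exists>k::int. x = y + real n * real_of_int k)"
proof -
  have "circle_point n x = circle_point n y \<longleftrightarrow> (\<exists>k::int. 2 * pi * x / n = 2 * pi * y / n + 2 * pi * k)"
    unfolding circle_point_def complex_eq_iff cis.sel sin_cos_eq_iff [symmetric] by auto
  also have "\<dots> \<longleftrightarrow> (\<exists>k::int. x = y + real n * real_of_int k)"
  proof (rule ex_cong1)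
    fix k :: int
    have "2 * pi * x / n = 2 * pi * y / n + 2 * pi * k \<longleftrightarrow> (2 * pi / n) * x = (2 * pi / n) * (y + real n * real_of_int k)"
      using assms by (simp add: field_simps)
    also have "\<dots> \<longleftrightarrow> x = y + real n * real_of_int k"
      using assms by (subst mult_cancel_left) auto
    finally show "2 * pi * x / n = 2 * pi * y / n + 2 * pi * k \<longleftrightarrow> x = y + real n * real_of_int k" .
  qed
  finally show ?thesis .
qed

lemma circle_point_add: "circle_point n (x + y) = circle_point n x * circle_point n y"
  by (simp add: circle_point_def cis_mult distrib_left add_divide_distrib)

lemma circle_point_in_sphere [simp]: "circle_point n x \<in> sphere 0 1"
  by (simp add: circle_point_def)

lemma circle_point_surj:
  assumes "n > 0" "z \<in> sphere 0 1"
  obtains x where "z = circle_point n x"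
proof
  have "cis (Arg z) = z" using assms cis_Arg [of z] by (force simp: sgn_eq)
  then show "z = circle_point n (Arg z * n / (2 * pi))"
    using assms by (simp add: circle_point_def)
qed

lemma continuous_map_circle_point:
  "continuous_map euclideanreal (top_of_set (sphere 0 1)) (circle_point n)"
  unfolding continuous_map_in_subtopology
  using circle_point_in_sphere by (auto simp: circle_point_def [abs_def] divide_inverse intro!: continuous_intros)

lemma cell_params_unit: "s \<in> cell_params b \<Longrightarrow> 0 \<le> s \<and> s < 1"
  by (auto simp: cell_params_def split: if_splits)

lemma cell_params_disjoint: "s \<in> cell_params b \<Longrightarrow> s \<in> cell_params b' \<Longrightarrow> b = b'"
  by (auto simp: cell_params_def split: if_splits)

lemma circle_point_params_unique:
  assumes n: "n > 0" and eq: "circle_point n (real_of_int a + s) = circle_point n (real_of_int a' + s')"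
    and s: "0 \<le> s" "s < 1" "0 \<le> s'" "s' < 1"
  shows "s = s'" "\<exists>k. a = a' + int n * k"
proof -
  obtain k :: int where k: "real_of_int a + s = real_of_int a' + s' + real n * real_of_int k"
    using eq circle_point_eq_iff [OF n] by blast
  then have "s - s' = of_int (a' + int n * k - a)" by simp
  moreover from this have "\<bar>real_of_int (a' + int n * k - a)\<bar> < 1" using s by linarith
  then have "a' + int n * k - a = 0" by linarith
  ultimately show "s = s'" "\<exists>k. a = a' + int n * k" by (auto intro: exI [of _ k])
qed

lemma circle_cell_shift:
  assumes "n > 0" shows "circle_cell n (a + int n * k) b = circle_cell n a b"
  unfolding circle_cell_def
proof (rule image_cong)
  fix s
  show "circle_point n (real_of_int (a + int n * k) + s) = circle_point n (real_of_int a + s)"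
    unfolding circle_point_eq_iff [OF assms] by (intro exI [of _ k]) simp
qed simp

lemma circle_cell_mod:
  assumes "n > 0" shows "circle_cell n (a mod int n) b = circle_cell n a b"
  using circle_cell_shift [OF assms, of "a mod int n" "a div int n" b] by simp

lemma circle_cell_subset: "circle_cell n a b \<subseteq> sphere 0 1"
  unfolding circle_cell_def using circle_point_in_sphere by blast

text \<open>A point of the circle determines its cell, and hence all points that lie at a given offset \<open>c\<close> from
  the initial vertex of that cell. The last part is used for the midpoint of a cell.\<close>

lemma circle_cell_unique:
  assumes n: "n > 0" and z: "z \<in> circle_cell n a b" "z \<in> circle_cell n a' b'"
  shows "b = b'" "circle_cell n a b = circle_cell n a' b'"
    "circle_point n (real_of_int a + c) = circle_point n (real_of_int a' + c)"
proof -
  obtain s s' where s: "s \<in> cell_params b" "s' \<in> cell_params b'"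
    and eq: "circle_point n (real_of_int a + s) = circle_point n (real_of_int a' + s')"
    using z by (auto simp: circle_cell_def)
  note unique = circle_point_params_unique [OF n eq]
  show b: "b = b'"
    using s unique(1) cell_params_unit cell_params_disjoint by metis
  obtain k where k: "a = a' + int n * k" using unique(2) s cell_params_unit by metis
  then show "circle_cell n a b = circle_cell n a' b'" using circle_cell_shift [OF n] b by simp
  show "circle_point n (real_of_int a + c) = circle_point n (real_of_int a' + c)"
    unfolding circle_point_eq_iff [OF n] k by (intro exI [of _ k]) simp
qed

lemma circle_cells_cover:
  assumes n: "n > 0" and z: "z \<in> sphere 0 1"
  shows "\<exists>a b. z \<in> circle_cell n a b"
proof -
  obtain x where "z = circle_point n x" using circle_point_surj [OF n z] by blast
  then have "z = circle_point n (real_of_int \<lfloor>x\<rfloor> + frac x)" by (simp add: frac_def)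
  moreover have "frac x \<in> cell_params (frac x > 0)"
    using frac_ge_0 [of x] frac_lt_1 [of x] by (auto simp: cell_params_def)
  ultimately show ?thesis unfolding circle_cell_def by blast
qed

definition torus_cell :: "nat \<Rightarrow> nat \<Rightarrow> (nat \<Rightarrow> int) \<Rightarrow> (nat \<Rightarrow> bool) \<Rightarrow> (nat \<Rightarrow> complex) set" where
  "torus_cell n m a b = (\<Pi>\<^sub>E i\<in>{..<m}. circle_cell n (a i) (b i))"

definition torus_cw :: "nat \<Rightarrow> nat \<Rightarrow> (nat \<Rightarrow> complex) cw" where
  "torus_cw n m = \<lparr>cw_space = torus m,
     cells = \<lambda>k. {torus_cell n m a b |a b. card {i \<in> {..<m}. b i} = k}\<rparr>"

lemma cw_space_torus_cw [simp]: "cw_space (torus_cw n m) = torus m"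
  by (simp add: torus_cw_def)

lemma cells_torus_cw: "cells (torus_cw n m) k = {torus_cell n m a b |a b. card {i \<in> {..<m}. b i} = k}"
  by (simp add: torus_cw_def)

lemma all_cells_torus_cw: "all_cells (torus_cw n m) = {torus_cell n m a b |a b. True}"
  by (auto simp: all_cells_def cells_torus_cw)

lemma torus_cell_iff:
  "x \<in> torus_cell n m a b \<longleftrightarrow>
    (\<exists>t. (\<forall>i<m. t i \<in> cell_params (b i)) \<and> x = (\<lambda>i\<in>{..<m}. circle_point n (real_of_int (a i) + t i)))"
proof
  assume x: "x \<in> torus_cell n m a b"
  then have "\<forall>i\<in>{..<m}. \<exists>s\<in>cell_params (b i). x i = circle_point n (real_of_int (a i) + s)"
    by (auto simp: torus_cell_def circle_cell_def PiE_iff)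
  then obtain t :: "nat \<Rightarrow> real" where t: "\<forall>i<m. t i \<in> cell_params (b i)"
    and xt: "\<And>i. i < m \<Longrightarrow> x i = circle_point n (real_of_int (a i) + t i)" by (metis lessThan_iff)
  have "x = (\<lambda>i\<in>{..<m}. circle_point n (real_of_int (a i) + t i))"
    using x xt by (auto simp: torus_cell_def PiE_iff extensional_def)
  with t show "\<exists>t. (\<forall>i<m. t i \<in> cell_params (b i)) \<and> x = (\<lambda>i\<in>{..<m}. circle_point n (real_of_int (a i) + t i))"
    by blast
next
  assume "\<exists>t. (\<forall>i<m. t i \<in> cell_params (b i)) \<and> x = (\<lambda>i\<in>{..<m}. circle_point n (real_of_int (a i) + t i))"
  then obtain t where "\<forall>i<m. t i \<in> cell_params (b i)"
    "x = (\<lambda>i\<in>{..<m}. circle_point n (real_of_int (a i) + t i))" by blast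
  then show "x \<in> torus_cell n m a b"
    by (simp add: torus_cell_def circle_cell_def restrict_PiE_iff)
qed

text \<open>The last part shows that the centre of a cell depends on the cell as a set only, and not on the
  indices \<open>a\<close> that describe it.\<close>

lemma torus_cell_unique:
  assumes n: "n > 0" and x: "x \<in> torus_cell n m a b" "x \<in> torus_cell n m a' b'"
  shows "torus_cell n m a b = torus_cell n m a' b'" "i < m \<Longrightarrow> b i = b' i"
    "i < m \<Longrightarrow> circle_point n (real_of_int (a i) + c) = circle_point n (real_of_int (a' i) + c)"
proof -
  have *: "x i \<in> circle_cell n (a i) (b i)" "x i \<in> circle_cell n (a' i) (b' i)" if "i < m" for i
    using x that by (auto simp: torus_cell_def)
  have "circle_cell n (a i) (b i) = circle_cell n (a' i) (b' i)" if "i \<in> {..<m}" for i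
    using that by (intro circle_cell_unique(2) [OF n *]) simp_all
  then show "torus_cell n m a b = torus_cell n m a' b'"
    unfolding torus_cell_def by (rule PiE_cong)
  show "b i = b' i" "circle_point n (real_of_int (a i) + c) = circle_point n (real_of_int (a' i) + c)"
    if "i < m" by (fact circle_cell_unique(1,3) [OF n * [OF that]])+
qed

lemma finite_all_cells_torus_cw:
  assumes "n > 0" shows "finite (all_cells (torus_cw n m))"
proof -
  define C where "C = (\<lambda>(a, b). circle_cell n a b) ` ({0..<int n} \<times> UNIV)"
  have C: "circle_cell n a b \<in> C" for a b
  proof -
    have "(a mod int n, b) \<in> {0..<int n} \<times> UNIV" using assms by simp
    then have "circle_cell n (a mod int n) b \<in> C" unfolding C_def by (metis (lifting) imageI case_prod_conv)
    then show ?thesis by (simp add: circle_cell_mod [OF assms])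
  qed
  have "all_cells (torus_cw n m) \<subseteq> (\<lambda>F. PiE {..<m} F) ` ({..<m} \<rightarrow>\<^sub>E C)"
  proof
    fix e assume "e \<in> all_cells (torus_cw n m)"
    then obtain a b where "e = torus_cell n m a b" by (auto simp: all_cells_torus_cw)
    also have "\<dots> = PiE {..<m} (\<lambda>i\<in>{..<m}. circle_cell n (a i) (b i))"
      unfolding torus_cell_def by (rule PiE_cong) simp
    finally have e: "e = PiE {..<m} (\<lambda>i\<in>{..<m}. circle_cell n (a i) (b i))" .
    show "e \<in> (\<lambda>F. PiE {..<m} F) ` ({..<m} \<rightarrow>\<^sub>E C)"
    proof (rule image_eqI, rule e)
      show "(\<lambda>i\<in>{..<m}. circle_cell n (a i) (b i)) \<in> {..<m} \<rightarrow>\<^sub>E C" by (simp add: C)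
    qed
  qed
  moreover have "finite C" by (simp add: C_def)
  ultimately show ?thesis by (meson finite_PiE finite_imageI finite_lessThan finite_subset)
qed

lemma partition_torus_cw:
  assumes n: "n > 0" shows "partition_on (topspace (torus m)) (all_cells (torus_cw n m))"
proof (rule partition_onI)
  have nonempty: "circle_cell n a b \<noteq> {}" for a b
    by (simp add: circle_cell_def cell_params_def)
  then have "torus_cell n m a b \<noteq> {}" for a b
    unfolding torus_cell_def PiE_eq_empty_iff by blast
  then show "{} \<notin> all_cells (torus_cw n m)"
    unfolding all_cells_torus_cw mem_Collect_eq by metis
  show "\<Union>(all_cells (torus_cw n m)) = topspace (torus m)"
  proof (intro equalityI subsetI)
    fix x assume "x \<in> \<Union>(all_cells (torus_cw n m))"
    then obtain a b where "x \<in> torus_cell n m a b" unfolding all_cells_torus_cw by auto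
    moreover have "torus_cell n m a b \<subseteq> topspace (torus m)"
      unfolding torus_cell_def topspace_torus by (intro PiE_mono circle_cell_subset)
    ultimately show "x \<in> topspace (torus m)" by blast
  next
    fix x assume x: "x \<in> topspace (torus m)"
    then have "\<forall>i\<in>{..<m}. \<exists>a b. x i \<in> circle_cell n a b"
      using circle_cells_cover [OF n] by (auto simp: topspace_torus PiE_iff)
    then obtain a b where "\<forall>i\<in>{..<m}. x i \<in> circle_cell n (a i) (b i)" by metis
    then have "x \<in> torus_cell n m a b" using x by (auto simp: torus_cell_def topspace_torus PiE_iff)
    then show "x \<in> \<Union>(all_cells (torus_cw n m))" unfolding all_cells_torus_cw by blast
  qed
  show "disjnt d e" if "d \<in> all_cells (torus_cw n m)" "e \<in> all_cells (torus_cw n m)" "d \<noteq> e" for d e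
  proof -
    obtain a b a' b' where "d = torus_cell n m a b" "e = torus_cell n m a' b'"
      using \<open>d \<in> _\<close> \<open>e \<in> _\<close> unfolding all_cells_torus_cw by force
    then show ?thesis
      using torus_cell_unique(1) [OF n, of _ m a b a' b'] that(3) unfolding disjnt_iff by metis
  qed
qed

text \<open>A \<open>k\<close>-cell is a product of \<open>k\<close> open arcs and some vertices, so the closed cube parametrizes its
  closure coordinatewise. The radial homeomorphism from the round disk to the cube turns this
  parametrization into a characteristic map.\<close>

lemma characteristic_map_torus_cw:
  fixes a :: "nat \<Rightarrow> int"
  assumes n: "n > 0" and k: "card {i \<in> {..<m}. b i} = k"
  shows "\<exists>f. characteristic_map (torus_cw n m) k (torus_cell n m a b) f"
proof -
  obtain \<sigma> where \<sigma>: "bij_betw \<sigma> {i \<in> {..<m}. b i} {..<k}"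
    using k finite_same_card_bij [of "{i \<in> {..<m}. b i}" "{..<k}"] by auto
  then have \<sigma>_less: "\<sigma> i < k" if "i < m" "b i" for i
    using that by (auto simp: bij_betw_def)
  have \<sigma>_surj: "\<exists>i<m. b i \<and> \<sigma> i = j" if "j < k" for j
    proof -
    have "j \<in> \<sigma> ` {i \<in> {..<m}. b i}" using bij_betw_imp_surj_on [OF \<sigma>] that by simp
    then show ?thesis by auto
  qed
  define t where "t x i = (if b i then (disk_to_cube k x (\<sigma> i) + 1) / 2 else 0)" for x i
  define f where "f x = (\<lambda>i\<in>{..<m}. circle_point n (a i + t x i))" for x
  have t_bounds: "0 \<le> t x i \<and> t x i \<le> 1" if "x \<in> topspace (disk k)" "i < m" for x i
    using disk_to_cube_le_eucl_norm [OF \<sigma>_less, of i x] that by (auto simp: t_def topspace_disk)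
  have t_params: "t x i \<in> cell_params (b i)" if "x \<in> open_disk k" "i < m" for x i
    using disk_to_cube_le_eucl_norm [OF \<sigma>_less, of i x] that
    by (auto simp: t_def open_disk_eq cell_params_def)
  have in_boundary: "f x \<in> (\<Union>j<k. \<Union>(cells (torus_cw n m) j)) \<and> f x \<notin> torus_cell n m a b"
    if x: "x \<in> disk_boundary k" for x
  proof -
    \<comment> \<open>A coordinate of the cube equal to \<open>-1\<close> or \<open>1\<close> lands on the initial or the final vertex of its
      arc, so the image lies in a cell with fewer arcs.\<close>
    define a' where "a' i = (if t x i = 1 then a i + 1 else a i)" for i
    define b' where "b' i \<longleftrightarrow> 0 < t x i \<and> t x i < 1" for i
    have "f x i \<in> circle_cell n (a' i) (b' i)" if "i < m" for i
      unfolding circle_cell_def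
    proof (rule image_eqI)
      show "f x i = circle_point n (a' i + (if b' i then t x i else 0))"
        using t_bounds [of x i] that x by (auto simp: f_def a'_def b'_def topspace_disk_decomp)
      show "(if b' i then t x i else 0) \<in> cell_params (b' i)"
        by (simp add: cell_params_def b'_def)
    qed
    then have fx: "f x \<in> torus_cell n m a' b'" by (auto simp: torus_cell_def f_def)
    have "sup_norm k (disk_to_cube k x) = 1"
      using x sup_norm_disk_to_cube [of k x] by (simp add: disk_boundary_eq)
    then obtain j where j: "j < k" "\<bar>disk_to_cube k x j\<bar> = 1"
      using sup_norm_attained [of k "disk_to_cube k x"] by auto
    obtain i where i: "i < m" "b i" "\<sigma> i = j" using \<sigma>_surj [OF j(1)] by blast
    then have "\<not> b' i" using j by (auto simp: b'_def t_def abs_if split: if_splits)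
    moreover have "b' i \<Longrightarrow> b i" for i by (auto simp: b'_def t_def split: if_splits)
    ultimately have "{i \<in> {..<m}. b' i} \<subset> {i \<in> {..<m}. b i}" using i by auto
    then have "card {i \<in> {..<m}. b' i} < k" unfolding k [symmetric] by (intro psubset_card_mono) auto
    then have "f x \<in> (\<Union>j<k. \<Union>(cells (torus_cw n m) j))" using fx unfolding cells_torus_cw by blast
    moreover have "f x \<notin> torus_cell n m a b"
      using torus_cell_unique(2) [OF n fx _ i(1)] i \<open>\<not> b' i\<close> by blast
    ultimately show ?thesis ..
  qed
  have "characteristic_map (torus_cw n m) k (torus_cell n m a b) f"
  proof (rule characteristic_mapI)
    show "Hausdorff_space (cw_space (torus_cw n m))" by (simp add: Hausdorff_space_torus)
    show "continuous_map (disk k) (cw_space (torus_cw n m)) f"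
      unfolding cw_space_torus_cw torus_def continuous_map_componentwise
    proof (intro conjI ballI)
      show "f ` topspace (disk k) \<subseteq> extensional {..<m}" by (auto simp: f_def)
      fix i assume i: "i \<in> {..<m}"
      have "continuous_map (disk k) euclideanreal (\<lambda>x. real_of_int (a i) + t x i)"
        unfolding t_def using \<sigma>_less i
        by (cases "b i") (auto intro!: continuous_intros continuous_map_disk_to_cube)
      from continuous_map_compose [OF this continuous_map_circle_point]
      show "continuous_map (disk k) (top_of_set (sphere 0 1)) (\<lambda>x. f x i)"
        using i by (simp add: f_def o_def)
    qed
    show "f ` open_disk k = torus_cell n m a b"
    proof (intro equalityI subsetI)
      fix y assume "y \<in> f ` open_disk k"
      then obtain x where "x \<in> open_disk k" "y = f x" by blast
      then show "y \<in> torus_cell n m a b"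
        using t_params by (simp add: f_def torus_cell_def circle_cell_def restrict_PiE_iff)
    next
      fix y assume y: "y \<in> torus_cell n m a b"
      then obtain s where s: "\<And>i. i < m \<Longrightarrow> s i \<in> cell_params (b i)"
        and y_eq: "y = (\<lambda>i\<in>{..<m}. circle_point n (real_of_int (a i) + s i))"
        unfolding torus_cell_iff by blast
      define \<tau> where "\<tau> = inv_into {i \<in> {..<m}. b i} \<sigma>"
      \<comment> \<open>The point of the cube with these arc parameters: \<open>(0, 1)\<close> is stretched back to \<open>(-1, 1)\<close>.\<close>
      define c where "c j = (if j < k then 2 * s (\<tau> j) - 1 else 0)" for j
      have \<tau>: "\<tau> (\<sigma> i) = i" if "i < m" "b i" for i
        using \<sigma> that by (simp add: \<tau>_def bij_betw_inv_into_left)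
      have c0: "\<forall>j\<ge>k. c j = 0" by (simp add: c_def)
      have c1: "\<bar>c j\<bar> < 1" if "j < k" for j
      proof -
        obtain i where "i < m" "b i" "\<sigma> i = j" using \<sigma>_surj \<open>j < k\<close> by blast
        then show ?thesis using s [of i] \<tau> [of i] \<open>j < k\<close> by (auto simp: c_def cell_params_def)
      qed
      then have "sup_norm k c < 1"
        using sup_norm_attained [of k c] by (metis zero_less_one)
      moreover have "\<forall>j\<ge>k. cube_to_disk k c j = 0"
        using c0 by (simp add: cube_to_disk_def rescale_def)
      ultimately have "cube_to_disk k c \<in> open_disk k"
        by (simp add: open_disk_eq eucl_norm_cube_to_disk [OF c0])
      moreover have "y = f (cube_to_disk k c)"
        unfolding y_eq f_def
      proof (rule restrict_ext)
        fix i assume "i \<in> {..<m}"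
        then have i: "i < m" by simp
        have "t (cube_to_disk k c) i = s i"
          using s [OF i] \<sigma>_less [OF i] \<tau> [OF i]
          by (auto simp: t_def disk_to_cube_cube_to_disk [OF c0] c_def cell_params_def)
        then show "circle_point n (real_of_int (a i) + s i)
            = circle_point n (real_of_int (a i) + t (cube_to_disk k c) i)" by simp
      qed
      ultimately show "y \<in> f ` open_disk k" by blast
    qed
    show "inj_on f (open_disk k)"
    proof (rule inj_onI)
      fix x y assume x: "x \<in> open_disk k" and y: "y \<in> open_disk k" and eq: "f x = f y"
      have "t x i = t y i" if "i < m" for i
      proof (rule circle_point_params_unique [OF n])
        show "circle_point n (real_of_int (a i) + t x i) = circle_point n (real_of_int (a i) + t y i)"
          using fun_cong [OF eq, of i] that by (simp add: f_def)
      qed (use cell_params_unit t_params x y that in blast)+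
      then have "disk_to_cube k x j = disk_to_cube k y j" for j
      proof (cases "j < k")
        case True
        then show ?thesis using \<sigma>_surj [OF True] \<open>\<And>i. i < m \<Longrightarrow> t x i = t y i\<close> by (fastforce simp: t_def)
      next
        case False
        then show ?thesis using x y by (simp add: open_disk_eq disk_to_cube_def rescale_def)
      qed
      then have "disk_to_cube k x = disk_to_cube k y" by blast
      moreover have "cube_to_disk k (disk_to_cube k z) = z" if "z \<in> open_disk k" for z
        using that by (intro cube_to_disk_disk_to_cube) (simp add: open_disk_eq)
      ultimately show "x = y" using x y by metis
    qed
    show "f ` disk_boundary k \<subseteq> (\<Union>j<k. \<Union>(cells (torus_cw n m) j))"
      "f ` disk_boundary k \<inter> torus_cell n m a b = {}"
      using in_boundary by blast+
  qed
  then show ?thesis by blast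
qed

text \<open>With finitely many cells in all, closure finiteness is trivial, and every set is the finite union of
  its intersections with the closures of cells, which gives the weak topology.\<close>

lemma cw_complex_torus_cw:
  assumes n: "n > 0" shows "cw_complex (torus_cw n m)"
  unfolding cw_complex_def
proof (intro conjI allI impI ballI)
  note part = partition_torus_cw [OF n, of m]
  note fin = finite_all_cells_torus_cw [OF n, of m]
  show "Hausdorff_space (cw_space (torus_cw n m))" by (simp add: Hausdorff_space_torus)
  show "partition_on (topspace (cw_space (torus_cw n m))) (all_cells (torus_cw n m))"
    using part by simp
  show "\<exists>f. characteristic_map (torus_cw n m) k e f" if "e \<in> cells (torus_cw n m) k" for k e
    using that characteristic_map_torus_cw [OF n] unfolding cells_torus_cw by blast
  show "finite {d \<in> all_cells (torus_cw n m). d \<inter> cw_space (torus_cw n m) closure_of e \<noteq> {}}" for e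
    using fin by simp
  fix A assume A: "A \<subseteq> topspace (cw_space (torus_cw n m))"
    and closed: "\<forall>e \<in> all_cells (torus_cw n m).
      closedin (cw_space (torus_cw n m)) (A \<inter> cw_space (torus_cw n m) closure_of e)"
  have "A = (\<Union>e \<in> all_cells (torus_cw n m). A \<inter> cw_space (torus_cw n m) closure_of e)"
  proof (intro equalityI subsetI)
    fix x assume x: "x \<in> A"
    then obtain e where "e \<in> all_cells (torus_cw n m)" "x \<in> e"
      using A partition_onD1 [OF part] by auto
    moreover from this have "x \<in> cw_space (torus_cw n m) closure_of e"
      using closure_of_subset [of e "torus m"] partition_onD1 [OF part] by auto
    ultimately show "x \<in> (\<Union>e \<in> all_cells (torus_cw n m). A \<inter> cw_space (torus_cw n m) closure_of e)"
      using x by blast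
  qed blast
  moreover have "closedin (cw_space (torus_cw n m))
      (\<Union>e \<in> all_cells (torus_cw n m). A \<inter> cw_space (torus_cw n m) closure_of e)"
    using fin closed by (intro closedin_Union) auto
  ultimately show "closedin (cw_space (torus_cw n m)) A" by (rule ssubst)
qed

section \<open>Monomial actions on tori\<close>

lemma root_of_unity_circle_point:
  assumes n: "n > 0" and w: "w ^ n = 1"
  obtains j :: int where "w = circle_point n (real_of_int j)"
proof -
  have "norm w ^ n = 1" using w by (metis norm_one norm_power)
  then have "norm w = 1" using n power_eq_imp_eq_base [of "norm w" n 1] by simp
  then obtain x where x: "w = circle_point n x" using circle_point_surj [OF n, of w] by auto
  have "circle_point 1 x = circle_point 1 0"
    using w n unfolding x circle_point_def Complex.DeMoivre by simp
  then obtain k :: int where "x = real_of_int k"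
    using circle_point_eq_iff [of 1 x 0] by auto
  then show thesis using x that by blast
qed

text \<open>The outer restriction is there because the elements of \<^const>\<open>BijGroup\<close> are extensional
  functions.\<close>

definition monomial_map :: "nat \<Rightarrow> (nat \<Rightarrow> complex) \<Rightarrow> (nat \<Rightarrow> nat) \<Rightarrow> (nat \<Rightarrow> complex) \<Rightarrow> nat \<Rightarrow> complex" where
  "monomial_map m w \<pi> = (\<lambda>t \<in> topspace (torus m). \<lambda>i\<in>{..<m}. w i * t (\<pi> i))"

lemma monomial_map_apply:
  "t \<in> topspace (torus m) \<Longrightarrow> i < m \<Longrightarrow> monomial_map m w \<pi> t i = w i * t (\<pi> i)"
  by (simp add: monomial_map_def)

lemma monomial_map_in_torus:
  assumes "\<And>i. i < m \<Longrightarrow> \<pi> i < m" "\<And>i. i < m \<Longrightarrow> norm (w i) = 1" "t \<in> topspace (torus m)"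
  shows "monomial_map m w \<pi> t \<in> topspace (torus m)"
  using assms by (auto simp: monomial_map_def topspace_torus PiE_iff norm_mult)

lemma continuous_map_monomial_map:
  assumes \<pi>: "\<And>i. i < m \<Longrightarrow> \<pi> i < m" and w: "\<And>i. i < m \<Longrightarrow> norm (w i) = 1"
  shows "continuous_map (torus m) (torus m) (monomial_map m w \<pi>)"
proof -
  have "continuous_map (torus m) (torus m) (\<lambda>t. \<lambda>i\<in>{..<m}. w i * t (\<pi> i))"
    unfolding torus_def continuous_map_componentwise
  proof (intro conjI ballI)
    fix i assume i: "i \<in> {..<m}"
    have "continuous_map (product_topology (\<lambda>i. top_of_set (sphere 0 1)) {..<m})
        (top_of_set (sphere 0 1)) (\<lambda>t. t (\<pi> i) :: complex)"
      using i \<pi> by (intro continuous_map_product_projection) simp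
    moreover have "continuous_map (top_of_set (sphere 0 1)) (top_of_set (sphere 0 1)) (\<lambda>z. w i * z)"
      using w [of i] i by (auto simp: norm_mult intro!: continuous_intros)
    ultimately have "continuous_map (product_topology (\<lambda>i. top_of_set (sphere 0 1)) {..<m})
        (top_of_set (sphere 0 1)) ((\<lambda>z. w i * z) \<circ> (\<lambda>t. t (\<pi> i)))"
      by (rule continuous_map_compose)
    then show "continuous_map (product_topology (\<lambda>i. top_of_set (sphere 0 1)) {..<m})
        (top_of_set (sphere 0 1)) (\<lambda>t. (\<lambda>i\<in>{..<m}. w i * t (\<pi> i)) i)"
      using i by (simp add: o_def)
  qed auto
  then show ?thesis
    by (rule continuous_map_eq) (simp add: monomial_map_def)
qed

lemma monomial_map_cell:
  assumes n: "n > 0" and \<pi>: "\<And>i. i < m \<Longrightarrow> \<pi> i < m"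
    and w: "\<And>i. i < m \<Longrightarrow> w i = circle_point n (real_of_int (j i))"
    and t: "\<And>i. i < m \<Longrightarrow> t i \<in> cell_params (b i)"
  shows "monomial_map m w \<pi> (\<lambda>i\<in>{..<m}. circle_point n (real_of_int (a i) + t i))
    = (\<lambda>i\<in>{..<m}. circle_point n (real_of_int (a (\<pi> i) + j i) + t (\<pi> i)))"
proof -
  have "(\<lambda>i\<in>{..<m}. circle_point n (real_of_int (a i) + t i)) \<in> topspace (torus m)"
    by (simp add: topspace_torus circle_point_def)
  then show ?thesis
    using \<pi> w by (auto simp: monomial_map_def fun_eq_iff circle_point_add [symmetric] algebra_simps)
qed

text \<open>The coefficients \<open>w\<close> form a cocycle over the action \<open>\<pi>\<close> of \<open>G\<close> on coordinates from the right. The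
  last hypothesis says that every non-trivial element rotates some coordinate that it does not permute,
  which makes the action free. Freeness then gives cellularity, since an element preserving a cell
  fixes its centre.\<close>

lemma monomial_action_in_N1_cell:
  fixes G :: "'a monoid" and \<pi> :: "'a \<Rightarrow> nat \<Rightarrow> nat" and w :: "'a \<Rightarrow> nat \<Rightarrow> complex"
  assumes G: "group G" and m: "m \<ge> 1" and n: "n > 0"
    and \<pi>: "\<And>g i. g \<in> carrier G \<Longrightarrow> i < m \<Longrightarrow> \<pi> g i < m"
    and root: "\<And>g i. g \<in> carrier G \<Longrightarrow> i < m \<Longrightarrow> w g i ^ n = 1"
    and \<pi>_one: "\<And>i. i < m \<Longrightarrow> \<pi> \<one>\<^bsub>G\<^esub> i = i" and w_one: "\<And>i. i < m \<Longrightarrow> w \<one>\<^bsub>G\<^esub> i = 1"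
    and \<pi>_mult: "\<And>g h i. g \<in> carrier G \<Longrightarrow> h \<in> carrier G \<Longrightarrow> i < m \<Longrightarrow> \<pi> (g \<otimes>\<^bsub>G\<^esub> h) i = \<pi> h (\<pi> g i)"
    and w_mult: "\<And>g h i. g \<in> carrier G \<Longrightarrow> h \<in> carrier G \<Longrightarrow> i < m \<Longrightarrow> w (g \<otimes>\<^bsub>G\<^esub> h) i = w g i * w h (\<pi> g i)"
    and free: "\<And>g. g \<in> carrier G \<Longrightarrow> g \<noteq> \<one>\<^bsub>G\<^esub> \<Longrightarrow> \<exists>i<m. \<pi> g i = i \<and> w g i \<noteq> 1"
  shows "G \<in> N1_cell P2"
proof -
  interpret group G by (rule G)
  define E where "E = topspace (torus m)"
  define \<phi> where "\<phi> g = monomial_map m (w g) (\<pi> g)" for g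
  have "\<exists>j. w g i = circle_point n (real_of_int j)" if "g \<in> carrier G" "i < m" for g i
    using root_of_unity_circle_point [OF n root [OF that]] by metis
  then obtain j where j: "\<And>g i. g \<in> carrier G \<Longrightarrow> i < m \<Longrightarrow> w g i = circle_point n (real_of_int (j g i))"
    by metis
  have norm_w: "norm (w g i) = 1" if "g \<in> carrier G" "i < m" for g i
    using j [OF that] by (simp add: circle_point_def)
  have closed: "\<phi> g t \<in> E" if "g \<in> carrier G" "t \<in> E" for g t
    using that \<pi> norm_w unfolding \<phi>_def E_def by (intro monomial_map_in_torus) auto
  have one: "\<phi> \<one>\<^bsub>G\<^esub> t = t" if "t \<in> E" for t
    using that \<pi>_one w_one by (auto simp: \<phi>_def monomial_map_def E_def topspace_torus PiE_iff extensional_def)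
  have mult: "\<phi> (g \<otimes>\<^bsub>G\<^esub> h) t = \<phi> g (\<phi> h t)" if "g \<in> carrier G" "h \<in> carrier G" "t \<in> E" for g h t
  proof
    fix i
    show "\<phi> (g \<otimes>\<^bsub>G\<^esub> h) t i = \<phi> g (\<phi> h t) i"
    proof (cases "i < m")
      case True
      then show ?thesis
        using that closed [OF that(2,3)] \<pi> [OF that(1)] unfolding \<phi>_def E_def
        by (simp add: monomial_map_apply \<pi>_mult w_mult)
    next
      case False
      then show ?thesis
        using that closed [OF that(2,3)] by (simp add: \<phi>_def E_def monomial_map_def [of m "w g"] monomial_map_def [of m "w (g \<otimes>\<^bsub>G\<^esub> h)"])
    qed
  qed
  have inv1: "\<phi> (inv\<^bsub>G\<^esub> g) (\<phi> g t) = t" and inv2: "\<phi> g (\<phi> (inv\<^bsub>G\<^esub> g) t) = t"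
    if "g \<in> carrier G" "t \<in> E" for g t
    using that one mult [of "inv\<^bsub>G\<^esub> g" g t] mult [of g "inv\<^bsub>G\<^esub> g" t] by simp_all
  have fixed_point: "g = \<one>\<^bsub>G\<^esub>" if g: "g \<in> carrier G" and t: "t \<in> E" "\<phi> g t = t" for g t
  proof (rule ccontr)
    assume "g \<noteq> \<one>\<^bsub>G\<^esub>"
    then obtain i where i: "i < m" "\<pi> g i = i" "w g i \<noteq> 1" using free [OF g] by blast
    then have "w g i * t i = t i"
      using fun_cong [OF t(2), of i] t(1) by (simp add: \<phi>_def E_def monomial_map_apply)
    moreover have "norm (t i) = 1"
      using t(1) i(1) by (auto simp: E_def topspace_torus PiE_iff)
    ultimately show False using i(3) by auto
  qed
  have Bij: "\<phi> g \<in> Bij E" if "g \<in> carrier G" for g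
  proof -
    have "bij_betw (\<phi> g) E E"
      by (rule bij_betwI [where g = "\<phi> (inv\<^bsub>G\<^esub> g)"]) (simp_all add: that closed inv1 inv2)
    moreover have "\<phi> g \<in> extensional E" by (simp add: \<phi>_def monomial_map_def E_def)
    ultimately show ?thesis by (simp add: Bij_def)
  qed
  have action: "group_action G E \<phi>"
  proof -
    have "\<phi> (g \<otimes>\<^bsub>G\<^esub> h) = compose E (\<phi> g) (\<phi> h)" if "g \<in> carrier G" "h \<in> carrier G" for g h
    proof (rule extensionalityI)
      show "\<phi> (g \<otimes>\<^bsub>G\<^esub> h) \<in> extensional E" using Bij that by (simp add: Bij_def)
    qed (use mult that in \<open>auto simp: compose_def\<close>)
    then have "\<phi> \<in> hom G (BijGroup E)"
      using Bij by (auto simp: hom_def BijGroup_def)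
    then show ?thesis
      using G group_BijGroup by (simp add: group_action_def group_hom_def group_hom_axioms_def)
  qed
  have cells_E: "e \<subseteq> E" if "e \<in> all_cells (torus_cw n m)" for e
    using that partition_onD1 [OF partition_torus_cw [OF n, of m]] by (auto simp: E_def)
  have cell_into: "\<phi> g ` torus_cell n m a b \<subseteq> torus_cell n m (\<lambda>i. a (\<pi> g i) + j g i) (\<lambda>i. b (\<pi> g i))"
    if g: "g \<in> carrier G" for g a b
  proof
    fix y assume "y \<in> \<phi> g ` torus_cell n m a b"
    then obtain t where t: "\<forall>i<m. t i \<in> cell_params (b i)"
      and y: "y = \<phi> g (\<lambda>i\<in>{..<m}. circle_point n (real_of_int (a i) + t i))"
      unfolding image_iff Bex_def torus_cell_iff by blast
    have "y = (\<lambda>i\<in>{..<m}. circle_point n (real_of_int (a (\<pi> g i) + j g i) + t (\<pi> g i)))"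
      unfolding y \<phi>_def using t by (intro monomial_map_cell [where b = b, OF n \<pi> [OF g] j [OF g]]) simp_all
    moreover have "\<forall>i<m. t (\<pi> g i) \<in> cell_params (b (\<pi> g i))" using t \<pi> [OF g] by simp
    ultimately show "y \<in> torus_cell n m (\<lambda>i. a (\<pi> g i) + j g i) (\<lambda>i. b (\<pi> g i))"
      unfolding torus_cell_iff by (intro exI [of _ "\<lambda>i. t (\<pi> g i)"] conjI)
  qed
  have cell_image: "\<phi> g ` e \<in> all_cells (torus_cw n m)"
    if g: "g \<in> carrier G" and e: "e \<in> all_cells (torus_cw n m)" for g e
  proof -
    obtain a b where ab: "e = torus_cell n m a b" using e by (auto simp: all_cells_torus_cw)
    have into: "\<exists>d \<in> all_cells (torus_cw n m). \<phi> h ` e \<subseteq> d"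
      if h: "h \<in> carrier G" and e: "e \<in> all_cells (torus_cw n m)" for h e
    proof -
      obtain a b where "e = torus_cell n m a b" using e by (auto simp: all_cells_torus_cw)
      then show ?thesis
        using cell_into [OF h, of a b]
        by (intro bexI [of _ "torus_cell n m (\<lambda>i. a (\<pi> h i) + j h i) (\<lambda>i. b (\<pi> h i))"])
          (auto simp: all_cells_torus_cw)
    qed
    \<comment> \<open>The inverse of \<open>g\<close> maps \<open>d\<close> into a cell that meets \<open>e\<close>, hence into \<open>e\<close>; so \<open>g\<close> maps \<open>e\<close>
      onto \<open>d\<close>.\<close>
    obtain d where d: "d \<in> all_cells (torus_cw n m)" "\<phi> g ` e \<subseteq> d" using into [OF g e] by blast
    obtain e' where e': "e' \<in> all_cells (torus_cw n m)" "\<phi> (inv\<^bsub>G\<^esub> g) ` d \<subseteq> e'"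
      using into [OF inv_closed [OF g] d(1)] by blast
    have "e \<subseteq> e'"
    proof
      fix x assume "x \<in> e"
      then show "x \<in> e'" using d(2) e'(2) inv1 [OF g, of x] cells_E [OF e] by (metis image_subset_iff subsetD)
    qed
    moreover have "e \<noteq> {}" using partition_onD3 [OF partition_torus_cw [OF n]] e by metis
    ultimately have "e = e'"
      using disjointD [OF partition_onD2 [OF partition_torus_cw [OF n]] e e'(1)] by blast
    have "d \<subseteq> \<phi> g ` e"
    proof
      fix y assume "y \<in> d"
      then have "\<phi> (inv\<^bsub>G\<^esub> g) y \<in> e" using e'(2) \<open>e = e'\<close> by blast
      then show "y \<in> \<phi> g ` e" using inv2 [OF g, of y] cells_E [OF d(1)] \<open>y \<in> d\<close> by (metis image_eqI subsetD)
    qed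
    then show ?thesis using d by (metis subset_antisym)
  qed
  have stable_cell: "g = \<one>\<^bsub>G\<^esub>"
    if g: "g \<in> carrier G" and e: "e \<in> all_cells (torus_cw n m)" and ge: "\<phi> g ` e = e" for g e
  proof -
    obtain a b where ab: "e = torus_cell n m a b" using e by (auto simp: all_cells_torus_cw)
    \<comment> \<open>Parameter \<open>1/2\<close> is the midpoint of an arc, so \<open>c\<close> below is the centre of the cell.\<close>
    define s where "s i = (if b i then 1/2 else 0 :: real)" for i
    define c where "c = (\<lambda>i\<in>{..<m}. circle_point n (real_of_int (a i) + s i))"
    have s: "s i \<in> cell_params (b i)" for i by (simp add: s_def cell_params_def)
    have c: "c \<in> e" unfolding ab torus_cell_iff c_def using s by (intro exI [of _ s]) simp
    have \<phi>c: "\<phi> g c = (\<lambda>i\<in>{..<m}. circle_point n (real_of_int (a (\<pi> g i) + j g i) + s (\<pi> g i)))"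
      unfolding \<phi>_def c_def using s by (intro monomial_map_cell [where b = b, OF n \<pi> [OF g] j [OF g]]) simp_all
    have old: "\<phi> g c \<in> torus_cell n m a b" using imageI [OF c, of "\<phi> g"] by (simp only: ge ab [symmetric])
    have new: "\<phi> g c \<in> torus_cell n m (\<lambda>i. a (\<pi> g i) + j g i) (\<lambda>i. b (\<pi> g i))"
      using cell_into [OF g, of a b] imageI [OF c, of "\<phi> g"] unfolding ab by (rule subsetD)
    have "\<phi> g c i = c i" for i
    proof (cases "i < m")
      case True
      have "s (\<pi> g i) = s i" using torus_cell_unique(2) [OF n new old True] by (simp add: s_def)
      then have "\<phi> g c i = circle_point n (real_of_int (a i) + s i)"
        using torus_cell_unique(3) [OF n new old True, of "s i"] True by (simp add: \<phi>c)
      then show ?thesis using True by (simp add: c_def)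
    next
      case False
      then have "\<phi> g c i = undefined" by (simp add: \<phi>c)
      then show ?thesis using False by (simp add: c_def)
    qed
    then show ?thesis using fixed_point [OF g] subsetD [OF cells_E [OF e] c] by (simp add: ext)
  qed
  have "cellular_action G (torus_cw n m) \<phi>"
    unfolding cellular_action_def cw_space_torus_cw
  proof (intro conjI ballI impI)
    show "group_action G (topspace (torus m)) \<phi>" using action by (simp add: E_def)
    show "homeomorphic_map (torus m) (torus m) (\<phi> g)" if g: "g \<in> carrier G" for g
    proof -
      have "continuous_map (torus m) (torus m) (\<phi> h)" if "h \<in> carrier G" for h
        unfolding \<phi>_def using \<pi> norm_w that by (intro continuous_map_monomial_map)
      then have "homeomorphic_maps (torus m) (torus m) (\<phi> g) (\<phi> (inv\<^bsub>G\<^esub> g))"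
        using g inv1 inv2 by (simp add: homeomorphic_maps_def E_def)
      then show ?thesis by (rule homeomorphic_maps_imp_map)
    qed
    show "\<phi> g x = x"
      if "g \<in> carrier G" "e \<in> all_cells (torus_cw n m)" "\<phi> g ` e = e" "x \<in> e" for g e x
      using stable_cell [OF that(1-3)] one subsetD [OF cells_E [OF that(2)] that(4)] by simp
  qed (rule cell_image)
  moreover have "carrier (isotropy_group G \<phi> x) = {\<one>\<^bsub>G\<^esub>}" if "x \<in> topspace (torus m)" for x
  proof -
    have "{g \<in> carrier G. \<phi> g x = x} = {\<one>\<^bsub>G\<^esub>}"
      using fixed_point [of _ x] one [of x] that unfolding E_def [symmetric] by auto
    then show ?thesis by (simp add: isotropy_group_def stabilizer_def)
  qed
  moreover have "torus_cw n m \<in> P2"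
    using cw_complex_torus_cw [OF n] m by (auto simp: P2_def)
  ultimately show ?thesis
    unfolding N1_cell_def by (auto intro!: bexI [of _ "torus_cw n m"] exI [of _ \<phi>])
qed

text \<open>The same for coordinates indexed by an arbitrary finite set, so that cosets can serve as indices.\<close>

lemma monomial_action_indexed_in_N1_cell:
  fixes G :: "'a monoid" and act :: "'a \<Rightarrow> 'i \<Rightarrow> 'i" and wt :: "'a \<Rightarrow> 'i \<Rightarrow> complex"
  assumes G: "group G" and I: "finite I" "I \<noteq> {}" and n: "n > 0"
    and act: "\<And>g i. g \<in> carrier G \<Longrightarrow> i \<in> I \<Longrightarrow> act g i \<in> I"
    and root: "\<And>g i. g \<in> carrier G \<Longrightarrow> i \<in> I \<Longrightarrow> wt g i ^ n = 1"
    and act_one: "\<And>i. i \<in> I \<Longrightarrow> act \<one>\<^bsub>G\<^esub> i = i" and wt_one: "\<And>i. i \<in> I \<Longrightarrow> wt \<one>\<^bsub>G\<^esub> i = 1"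
    and act_mult: "\<And>g h i. g \<in> carrier G \<Longrightarrow> h \<in> carrier G \<Longrightarrow> i \<in> I \<Longrightarrow> act (g \<otimes>\<^bsub>G\<^esub> h) i = act h (act g i)"
    and wt_mult: "\<And>g h i. g \<in> carrier G \<Longrightarrow> h \<in> carrier G \<Longrightarrow> i \<in> I \<Longrightarrow>
      wt (g \<otimes>\<^bsub>G\<^esub> h) i = wt g i * wt h (act g i)"
    and free: "\<And>g. g \<in> carrier G \<Longrightarrow> g \<noteq> \<one>\<^bsub>G\<^esub> \<Longrightarrow> \<exists>i\<in>I. act g i = i \<and> wt g i \<noteq> 1"
  shows "G \<in> N1_cell P2"
proof -
  obtain \<beta> where \<beta>: "bij_betw \<beta> {..<card I} I"
    using ex_bij_betw_nat_finite [OF I(1)] by (auto simp: atLeast0LessThan)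
  define \<gamma> where "\<gamma> = inv_into {..<card I} \<beta>"
  have \<beta>_in: "\<beta> i \<in> I" if "i < card I" for i using \<beta> that by (auto simp: bij_betw_def)
  have \<gamma>_less: "\<gamma> x < card I" if "x \<in> I" for x
    using bij_betw_inv_into [OF \<beta>] that by (auto simp: \<gamma>_def bij_betw_def)
  have \<beta>\<gamma>: "\<beta> (\<gamma> x) = x" if "x \<in> I" for x
    using \<beta> that by (simp add: \<gamma>_def bij_betw_inv_into_right)
  have \<gamma>\<beta>: "\<gamma> (\<beta> i) = i" if "i < card I" for i
    using \<beta> that by (simp add: \<gamma>_def bij_betw_inv_into_left)
  show ?thesis
  proof (rule monomial_action_in_N1_cell [where m = "card I" and n = n
        and \<pi> = "\<lambda>g i. \<gamma> (act g (\<beta> i))" and w = "\<lambda>g i. wt g (\<beta> i)"])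
    show "card I \<ge> 1" using I by (simp add: Suc_le_eq card_gt_0_iff)
    show "\<exists>i<card I. \<gamma> (act g (\<beta> i)) = i \<and> wt g (\<beta> i) \<noteq> 1" if g: "g \<in> carrier G" "g \<noteq> \<one>\<^bsub>G\<^esub>" for g
    proof -
      obtain x where "x \<in> I" "act g x = x" "wt g x \<noteq> 1" using free [OF g] by blast
      then show ?thesis by (intro exI [of _ "\<gamma> x"]) (simp add: \<gamma>_less \<beta>\<gamma>)
    qed
  qed (simp_all add: G n act root act_one wt_one act_mult wt_mult \<beta>_in \<gamma>_less \<beta>\<gamma> \<gamma>\<beta>)
qed

section \<open>Free monomial actions of finite groups\<close>

context group begin

definition coset_rep :: "'a \<Rightarrow> 'a \<Rightarrow> 'a" where
  "coset_rep c x = (SOME y. y \<in> carrier G \<and> (\<exists>k::int. x = y \<otimes> c [^] k))"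

text \<open>If \<open>x = r c\<^sup>k\<close> with \<open>r\<close> the chosen representative of the left coset of \<open>x\<close> modulo the powers of
  \<open>c\<close>, this is \<open>\<omega>\<^sup>k\<close> for a primitive root of unity \<open>\<omega>\<close> of order \<open>ord c\<close>. It trivializes the
  coinduced torus: the functions \<open>f\<close> with \<open>f (x c) = \<omega> f x\<close> are the products of the phase with the
  functions that are constant on left cosets.\<close>

definition coset_phase :: "'a \<Rightarrow> 'a \<Rightarrow> complex" where
  "coset_phase c x = circle_point (ord c) (real_of_int (SOME k::int. x = coset_rep c x \<otimes> c [^] k))"

lemma coset_rep:
  assumes "c \<in> carrier G" "x \<in> carrier G"
  shows coset_rep_closed: "coset_rep c x \<in> carrier G"
    and coset_rep_pow: "\<exists>k::int. x = coset_rep c x \<otimes> c [^] k"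
proof -
  have "x = x \<otimes> c [^] (0::int)" using assms by simp
  then have "\<exists>y. y \<in> carrier G \<and> (\<exists>k::int. x = y \<otimes> c [^] k)" using assms by blast
  from someI_ex [OF this] show "coset_rep c x \<in> carrier G" "\<exists>k::int. x = coset_rep c x \<otimes> c [^] k"
    by (simp_all add: coset_rep_def)
qed

lemma coset_rep_mult_pow:
  assumes c: "c \<in> carrier G" and x: "x \<in> carrier G"
  shows "coset_rep c (x \<otimes> c [^] (k::int)) = coset_rep c x"
proof -
  have "(\<exists>j::int. x \<otimes> c [^] k = y \<otimes> c [^] j) \<longleftrightarrow> (\<exists>j::int. x = y \<otimes> c [^] j)" if y: "y \<in> carrier G" for y
  proof
    assume "\<exists>j::int. x \<otimes> c [^] k = y \<otimes> c [^] j"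
    then obtain j :: int where j: "x \<otimes> c [^] k = y \<otimes> c [^] j" by blast
    have "x = (x \<otimes> c [^] k) \<otimes> c [^] (- k)"
      using c x by (simp add: m_assoc int_pow_neg)
    also have "\<dots> = y \<otimes> c [^] (j + (- k))"
      unfolding j using c y by (simp only: m_assoc int_pow_mult int_pow_closed)
    finally show "\<exists>j::int. x = y \<otimes> c [^] j" ..
  next
    assume "\<exists>j::int. x = y \<otimes> c [^] j"
    then obtain j :: int where "x = y \<otimes> c [^] j" by blast
    then have "x \<otimes> c [^] k = y \<otimes> c [^] (j + k)" using c y by (simp add: m_assoc int_pow_mult)
    then show "\<exists>j::int. x \<otimes> c [^] k = y \<otimes> c [^] j" ..
  qed
  then show ?thesis unfolding coset_rep_def by (intro arg_cong [where f = Eps] ext) auto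
qed

lemma coset_rep_idem:
  assumes c: "c \<in> carrier G" and x: "x \<in> carrier G"
  shows "coset_rep c (coset_rep c x) = coset_rep c x"
  using coset_rep [OF c x] coset_rep_mult_pow [OF c coset_rep_closed [OF c x]] by metis

text \<open>This holds although the exponent of \<open>c\<close> in \<open>x = r c\<^sup>k\<close> is determined modulo \<open>ord c\<close> only, because
  \<open>\<omega>\<close> has order \<open>ord c\<close>.\<close>

lemma coset_phase_mult_pow:
  assumes c: "c \<in> carrier G" and x: "x \<in> carrier G" and ord: "ord c > 0"
  shows "coset_phase c (x \<otimes> c [^] (k::int)) = coset_phase c x * circle_point (ord c) (real_of_int k)"
proof -
  define r where "r = coset_rep c x"
  have r: "r \<in> carrier G" using coset_rep_closed [OF c x] by (simp add: r_def)
  define i where "i = (SOME k::int. x = r \<otimes> c [^] k)"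
  have i: "x = r \<otimes> c [^] i"
    using someI_ex [OF coset_rep_pow [OF c x]] by (simp add: i_def r_def)
  define j where "j = (SOME j::int. x \<otimes> c [^] k = r \<otimes> c [^] j)"
  have rep: "coset_rep c (x \<otimes> c [^] k) = r" by (simp add: r_def coset_rep_mult_pow [OF c x])
  have j: "x \<otimes> c [^] k = r \<otimes> c [^] j"
    using someI_ex [OF coset_rep_pow [of c "x \<otimes> c [^] k"]] c x by (simp add: j_def rep)
  have "r \<otimes> c [^] (i + k) = r \<otimes> c [^] j"
    using c r by (simp add: int_pow_mult m_assoc [symmetric] i [symmetric] j [symmetric])
  then have "c [^] (i + k) = c [^] j" using c r by simp
  then have "int (ord c) dvd j - (i + k)" using int_pow_eq [OF c] by blast
  then obtain l where "j = i + k + int (ord c) * l" by (metis add_diff_cancel_left' diff_add_cancel dvdE add.commute)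
  then have "circle_point (ord c) (real_of_int j) = circle_point (ord c) (real_of_int i + real_of_int k)"
    unfolding circle_point_eq_iff [OF ord] by (intro exI [of _ l]) simp
  then show ?thesis
    by (simp add: coset_phase_def rep i_def [symmetric] j_def [symmetric] r_def [symmetric] circle_point_add)
qed

lemma coset_phase_pow_order:
  assumes c: "c \<in> carrier G" and ord: "ord c > 0" "ord c dvd n"
  shows "coset_phase c x ^ n = 1"
proof -
  define k where "k = (SOME k::int. x = coset_rep c x \<otimes> c [^] k)"
  obtain q where q: "n = ord c * q" using ord(2) by blast
  have "circle_point (ord c) (real_of_int k) ^ n = cis (2 * pi * real_of_int (int q * k))"
    using ord(1) unfolding circle_point_def Complex.DeMoivre q by (simp add: field_simps)
  also have "\<dots> = 1" by (simp add: cis_multiple_2pi)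
  finally show ?thesis by (simp add: coset_phase_def k_def)
qed

lemma coset_phase_nonzero: "coset_phase c x \<noteq> 0"
  by (simp add: coset_phase_def circle_point_def)

text \<open>The coset of \<open>g x\<close> and the ratio of the phases of \<open>g x\<close> and \<open>x\<close> depend on the left coset of
  \<open>x\<close> only: replacing \<open>x\<close> by \<open>x c\<^sup>k\<close> multiplies both phases by the same factor. Therefore the action
  on functions descends to coordinates indexed by cosets.\<close>

lemma
  assumes c: "c \<in> carrier G" and x: "x \<in> carrier G" and g: "g \<in> carrier G" and ord: "ord c > 0"
  shows coset_rep_mult_rep: "coset_rep c (g \<otimes> coset_rep c x) = coset_rep c (g \<otimes> x)"
    and coset_phase_ratio_rep: "coset_phase c (g \<otimes> coset_rep c x) / coset_phase c (coset_rep c x)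
      = coset_phase c (g \<otimes> x) / coset_phase c x"
proof -
  obtain k :: int where k: "x = coset_rep c x \<otimes> c [^] k" using coset_rep_pow [OF c x] by blast
  define r where "r = coset_rep c x"
  have r: "r \<in> carrier G" using coset_rep_closed [OF c x] by (simp add: r_def)
  have x_eq: "x = r \<otimes> c [^] k" using k by (simp add: r_def)
  have gx: "g \<otimes> x = (g \<otimes> r) \<otimes> c [^] k" using c g r by (simp add: x_eq m_assoc)
  show "coset_rep c (g \<otimes> coset_rep c x) = coset_rep c (g \<otimes> x)"
    using c g r unfolding gx r_def [symmetric] by (simp add: coset_rep_mult_pow)
  have "coset_phase c (g \<otimes> x) = coset_phase c (g \<otimes> r) * circle_point (ord c) (real_of_int k)"
    unfolding gx using c g r ord by (intro coset_phase_mult_pow) auto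
  moreover have "coset_phase c x = coset_phase c r * circle_point (ord c) (real_of_int k)"
    using coset_phase_mult_pow [OF c r ord, of k] x_eq by simp
  moreover have "circle_point (ord c) (real_of_int k) \<noteq> 0" by (simp add: circle_point_def)
  ultimately show "coset_phase c (g \<otimes> coset_rep c x) / coset_phase c (coset_rep c x)
      = coset_phase c (g \<otimes> x) / coset_phase c x"
    unfolding r_def [symmetric] by simp
qed

end

text \<open>The coordinates are the pairs of an element \<open>c\<close> and a left coset modulo the powers of \<open>c\<close>, given
  by its representative \<open>r\<close>. Translating \<open>f\<close> by \<open>g\<close> gives \<open>x \<mapsto> f (g\<^sup>-\<^sup>1 x)\<close>, and dividing by the
  phase at \<open>r\<close> gives the coefficient \<open>wt g\<close>; the cocycle identity is a telescoping product. A
  non-trivial \<open>g\<close> is detected at \<open>c = g\<^sup>-\<^sup>1\<close> and the coset of \<open>\<one>\<close>, where its coefficient is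
  \<open>\<omega> \<noteq> 1\<close>.\<close>

lemma finite_group_in_N1_cell:
  assumes G: "group G" and fin: "finite (carrier G)"
  shows "G \<in> N1_cell P2"
proof -
  interpret group G by (rule G)
  have ord: "ord c > 0" if "c \<in> carrier G" for c using ord_ge_1 [OF fin that] by simp
  define I where "I = (\<lambda>(c, x). (c, coset_rep c x)) ` (carrier G \<times> carrier G)"
  define act where "act g = (\<lambda>(c, r). (c, coset_rep c (inv\<^bsub>G\<^esub> g \<otimes>\<^bsub>G\<^esub> r)))" for g
  define wt where "wt g = (\<lambda>(c, r). coset_phase c (inv\<^bsub>G\<^esub> g \<otimes>\<^bsub>G\<^esub> r) / coset_phase c r)" for g
  have I: "\<exists>c \<in> carrier G. \<exists>r \<in> carrier G. i = (c, r) \<and> coset_rep c r = r" if "i \<in> I" for i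
    using that by (auto simp: I_def coset_rep_closed coset_rep_idem)
  have in_I: "(c, coset_rep c x) \<in> I" if "c \<in> carrier G" "x \<in> carrier G" for c x
    using that by (auto simp: I_def)
  show ?thesis
  proof (rule monomial_action_indexed_in_N1_cell [OF G, where I = I and n = "order G" and act = act and wt = wt])
    show "finite I" "I \<noteq> {}" using fin by (auto simp: I_def)
    show "order G > 0" using fin by (simp add: order_gt_0_iff_finite)
    show "act \<one>\<^bsub>G\<^esub> i = i" "wt \<one>\<^bsub>G\<^esub> i = 1" if "i \<in> I" for i
      using I [OF that] by (auto simp: act_def wt_def coset_phase_nonzero)
    fix g i assume g: "g \<in> carrier G"
    show "\<exists>i\<in>I. act g i = i \<and> wt g i \<noteq> 1" if "g \<noteq> \<one>\<^bsub>G\<^esub>"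
    proof -
      define c where "c = inv\<^bsub>G\<^esub> g"
      have c: "c \<in> carrier G" "c \<noteq> \<one>\<^bsub>G\<^esub>" using g that by (auto simp: c_def)
      have c_pow: "c = \<one>\<^bsub>G\<^esub> \<otimes>\<^bsub>G\<^esub> c [^]\<^bsub>G\<^esub> (1::int)" using c by simp
      have "ord c \<noteq> 1" using c ord_eq_1 by blast
      then have "ord c > 1" using ord [OF c(1)] by linarith
      have "circle_point (ord c) 1 \<noteq> circle_point (ord c) 0"
      proof
        assume "circle_point (ord c) 1 = circle_point (ord c) 0"
        then obtain k :: int where "1 = real (ord c) * real_of_int k"
          using circle_point_eq_iff [OF ord [OF c(1)]] by auto
        then have "1 = int (ord c) * k" by (metis of_int_1 of_int_eq_iff of_int_mult of_int_of_nat_eq)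
        then show False using \<open>ord c > 1\<close> by (auto simp: zmult_eq_1_iff dest!: sym [of 1])
      qed
      then have "circle_point (ord c) 1 \<noteq> 1" by (simp add: circle_point_def)
      moreover have "coset_phase c c = coset_phase c \<one>\<^bsub>G\<^esub> * circle_point (ord c) 1"
        using coset_phase_mult_pow [OF c(1) one_closed ord [OF c(1)], of 1] c by simp
      ultimately have "wt g (c, coset_rep c \<one>\<^bsub>G\<^esub>) \<noteq> 1"
        using coset_phase_ratio_rep [OF c(1) one_closed c(1) ord [OF c(1)]] c coset_phase_nonzero [of c "\<one>\<^bsub>G\<^esub>"]
        by (simp add: wt_def c_def [symmetric])
      moreover have "act g (c, coset_rep c \<one>\<^bsub>G\<^esub>) = (c, coset_rep c \<one>\<^bsub>G\<^esub>)"
        using coset_rep_mult_rep [OF c(1) one_closed c(1) ord [OF c(1)]] c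
          coset_rep_mult_pow [OF c(1) one_closed, of 1]
        by (simp add: act_def c_def [symmetric])
      ultimately show ?thesis using in_I [OF c(1) one_closed] by blast
    qed
    assume i: "i \<in> I"
    obtain c r where c: "c \<in> carrier G" and r: "r \<in> carrier G" and ir: "i = (c, r)" and rep: "coset_rep c r = r"
      using I [OF i] by blast
    show "act g i \<in> I" using g c r by (auto simp: act_def ir intro: in_I)
    show "wt g i ^ order G = 1"
      using coset_phase_pow_order [OF c ord [OF c] ord_dvd_group_order [OF c]]
      by (simp add: wt_def ir power_divide)
    fix h assume h: "h \<in> carrier G"
    have gh: "inv\<^bsub>G\<^esub> (g \<otimes>\<^bsub>G\<^esub> h) \<otimes>\<^bsub>G\<^esub> r = inv\<^bsub>G\<^esub> h \<otimes>\<^bsub>G\<^esub> (inv\<^bsub>G\<^esub> g \<otimes>\<^bsub>G\<^esub> r)"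
      using g h r by (simp add: inv_mult_group m_assoc)
    have gr: "inv\<^bsub>G\<^esub> g \<otimes>\<^bsub>G\<^esub> r \<in> carrier G" using g r by simp
    show "act (g \<otimes>\<^bsub>G\<^esub> h) i = act h (act g i)"
      using coset_rep_mult_rep [OF c gr inv_closed [OF h] ord [OF c]] by (simp add: act_def ir gh)
    show "wt (g \<otimes>\<^bsub>G\<^esub> h) i = wt g i * wt h (act g i)"
      using coset_phase_ratio_rep [OF c gr inv_closed [OF h] ord [OF c]]
      by (simp add: wt_def act_def ir gh coset_phase_nonzero)
  qed
qed

section \<open>The class of finite groups\<close>

theorem proposition3p3:
  shows "(N_cell P2 :: 'a monoid set) = N1_cell P2 \<and>
         (N1_cell P2 :: 'a monoid set) = {G. group G \<and> finite (carrier G)}"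
proof -
  have "(N1_cell P2 :: 'a monoid set) \<subseteq> N_cell P2" by (rule N1_cell_subset_N_cell)
  moreover have "(N_cell P2 :: 'a monoid set) \<subseteq> {G. group G \<and> finite (carrier G)}"
    using N_cell_P2_finite by blast
  moreover have "{G :: 'a monoid. group G \<and> finite (carrier G)} \<subseteq> N1_cell P2"
    using finite_group_in_N1_cell by blast
  ultimately show ?thesis by blast
qed

end
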